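(* Let $n\ge 1$ and $[n]=\{1,\dots,n\}$. Each single-peaked preference $\sigma=i_1 i_2\cdots i_n$ on $[n]$ has a sign representation, i.e. a well-defined sequence $s(\sigma)=(s_1,\dots,s_{n-1})\in\{+,-\}^{n-1}$ of length $n-1$ (as defined in the context), and this sequence uniquely specifies the preference: if $\sigma,\tau$ are single-peaked preferences on $[n]$ with $s(\sigma)=s(\tau)$, then $\sigma=\tau$.
   Context: A preference (linear order) $\sigma$ on $[n]=\{1,\dots,n\}$ is written as a word $i_1 i_2\cdots i_n$, a permutation of $[n]$ listed from the most preferred alternative $i_1$ (the top, or peak) to the least preferred $i_n$. Write $a\succ b$ if $a$ is preferred to $b$, i.e. $a$ occurs before $b$ in the word. The preference with peak $k=i_1$ is single-peaked (with respect to the fixed axis $1<2<\cdots<n$) if for all $k_1,k_2\in[n]$, $k_2<k_1\le k$ or $k_2>k_1\ge k$ implies $k_1\succ k_2$. Sign representation: for a preference $\sigma=i_1\cdots i_n$ and $1\le p\le n-1$, the sign $s_p$ is $+$ if $i_{p+1}=\max\{i_1,\dots,i_p\}+1$, and $s_p$ is $-$ if $i_{p+1}=\min\{i_1,\dots,i_p\}-1$. The sequence $s(\sigma)=(s_1,\dots,s_{n-1})$ is well defined when for every $p$ exactly one of these two cases occurs. For example, with $n=5$, $34251$ has sign representation $+-+-$, and $23415$ has sign representation $++-+$. *)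

theory Defs
  imports "HOL-Combinatorics.Multiset_Permutations"
begin

text \<open>
  A preference on \<open>{1..n}\<close> is a word \<open>\<sigma> \<in> permutations_of_set {1..n}\<close>, listed from the most to the
  least preferred alternative. Lists are indexed from 0, so the letter \<open>i\<^sub>p\<close> is \<open>\<sigma> ! (p - 1)\<close>.
\<close>

definition preferred :: "nat list \<Rightarrow> nat \<Rightarrow> nat \<Rightarrow> bool" where
  "preferred \<sigma> a b \<longleftrightarrow> (\<exists>p q. p < q \<and> q < length \<sigma> \<and> \<sigma> ! p = a \<and> \<sigma> ! q = b)"

text \<open>For \<open>n \<ge> 1\<close> the word is nonempty and \<open>hd \<sigma>\<close> is its peak.\<close>

definition single_peaked :: "nat \<Rightarrow> nat list \<Rightarrow> bool" where
  "single_peaked n \<sigma> \<longleftrightarrow>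
     \<sigma> \<in> permutations_of_set {1..n} \<and>
     (\<forall>k1\<in>{1..n}. \<forall>k2\<in>{1..n}.
        (k2 < k1 \<and> k1 \<le> hd \<sigma>) \<or> (k2 > k1 \<and> k1 \<ge> hd \<sigma>) \<longrightarrow> preferred \<sigma> k1 k2)"

datatype sign = Plus | Minus

text \<open>
  \<open>sign_case \<sigma> p c\<close> says that the case defining \<open>s\<^sub>p = c\<close> occurs, for \<open>1 \<le> p < length \<sigma>\<close>: here \<open>\<sigma> ! p\<close>
  is \<open>i\<^sub>p\<^sub>+\<^sub>1\<close> and \<open>take p \<sigma>\<close> is \<open>i\<^sub>1 \<dots> i\<^sub>p\<close>. The second equation adds 1 on the left instead of
  subtracting it on the right, avoiding truncated subtraction.
\<close>

primrec sign_case :: "nat list \<Rightarrow> nat \<Rightarrow> sign \<Rightarrow> bool" where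
  "sign_case \<sigma> p Plus \<longleftrightarrow> \<sigma> ! p = Max (set (take p \<sigma>)) + 1"
| "sign_case \<sigma> p Minus \<longleftrightarrow> \<sigma> ! p + 1 = Min (set (take p \<sigma>))"

definition sign_rep_well_defined :: "nat list \<Rightarrow> bool" where
  "sign_rep_well_defined \<sigma> \<longleftrightarrow> (\<forall>p\<in>{1..<length \<sigma>}. \<exists>!c. sign_case \<sigma> p c)"

text \<open>Meaningful only under \<^const>\<open>sign_rep_well_defined\<close>.\<close>

definition sign_rep :: "nat list \<Rightarrow> sign list" where
  "sign_rep \<sigma> = map (\<lambda>p. THE c. sign_case \<sigma> p c) [1..<length \<sigma>]"

lemma sign_rep_34251: "sign_rep [3, 4, 2, 5, 1] = [Plus, Minus, Plus, Minus]"
proof -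
  have "(THE c. P c) = Plus" if "P Plus" "\<not> P Minus" for P
    using that by (metis (full_types) sign.exhaust the_equality)
  moreover have "(THE c. P c) = Minus" if "\<not> P Plus" "P Minus" for P
    using that by (metis (full_types) sign.exhaust the_equality)
  ultimately show ?thesis
    by (simp add: sign_rep_def upt_conv_Cons numeral_eq_Suc)
qed

end

(* In a single-peaked word every prefix is an interval around the peak, so the next letter extends
   this interval by one on the right or on the left. Conversely the word can be read off its signs
   from the end: the last letter of a prefix is the maximum or minimum of the letters of that
   prefix, and those are the letters left over by the part of the word already recovered. *)
theory Submission
  imports Defs
begin

lemma set_take_eq_diff_drop:
  assumes "distinct xs"
  shows "set (take p xs) = set xs - set (drop p xs)"
proof -
  have "set xs = set (take p xs) \<union> set (drop p xs)"
    by (metis append_take_drop_id set_append)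
  then show ?thesis
    using set_take_disj_set_drop_if_distinct[OF assms order_refl, of p] by blast
qed

text \<open>Distinctness pins the less preferred letter to position \<open>p\<close>, so the index
  witnessing the preference lies below \<open>p\<close>.\<close>

lemma preferred_nth_in_take:
  assumes "distinct \<sigma>" "p < length \<sigma>" "preferred \<sigma> a (\<sigma> ! p)"
  shows "a \<in> set (take p \<sigma>)"
proof -
  obtain i j where ij: "i < j" "j < length \<sigma>" "\<sigma> ! i = a" "\<sigma> ! j = \<sigma> ! p"
    using assms(3) by (auto simp: preferred_def)
  then have "j = p"
    using assms by (simp add: nth_eq_iff_index_eq)
  then show ?thesis
    using ij by (auto simp: in_set_conv_nth)
qed

text \<open>The letter \<open>\<sigma> ! p\<close> falls outside the range from \<open>m\<close> to
  \<open>M\<close>. If it skipped the neighbour \<open>M + 1\<close> or \<open>m - 1\<close>, that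
  neighbour would lie strictly closer to the peak on the same side, hence occur earlier, against the
  choice of \<open>M\<close> or \<open>m\<close>.\<close>

lemma single_peaked_sign_case_ex1:
  assumes sp: "single_peaked n \<sigma>" and p: "1 \<le> p" "p < length \<sigma>"
  shows "\<exists>!c. sign_case \<sigma> p c"
proof -
  define S M m where "S = set (take p \<sigma>)" and "M = Max S" and "m = Min S"
  have perm: "set \<sigma> = {1..n}" "distinct \<sigma>"
    using sp by (auto simp: single_peaked_def permutations_of_set_def)
  have hd: "hd \<sigma> \<in> S"
    using p by (metis S_def hd_in_set hd_take less_zeroE list.size(3) not_one_le_zero
        take_eq_Nil neq0_conv)
  have fin: "finite S"
    by (simp add: S_def)
  have ne: "S \<noteq> {}"
    using hd by auto
  have between: "m \<le> hd \<sigma>" "hd \<sigma> \<le> M"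
    using hd fin by (auto simp: m_def M_def)
  have sub: "S \<subseteq> {1..n}"
    using perm set_take_subset[of p \<sigma>] by (auto simp: S_def)
  have M: "M \<in> S" "M \<in> {1..n}" and m: "m \<in> S" "m \<in> {1..n}"
    using Max_in[OF fin ne] Min_in[OF fin ne] sub by (auto simp: M_def m_def)
  have x: "\<sigma> ! p \<in> {1..n}"
    using perm(1) p(2) nth_mem by blast
  have "\<sigma> ! p \<in> set (drop p \<sigma>)"
    by (metis Cons_nth_drop_Suc list.set_intros(1) p(2))
  then have x_notin: "\<sigma> ! p \<notin> S"
    by (simp add: S_def set_take_eq_diff_drop perm(2))
  \<comment> \<open>The position \<open>q\<close> is kept general: \<open>convex\<close> uses it at
    the position of an earlier letter, the adjacency steps use it at \<open>p\<close>
    itself.\<close>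
  have earlier: "a \<in> set (take q \<sigma>)"
    if q: "q < length \<sigma>" and a: "a \<in> {1..n}"
      "\<sigma> ! q < a \<and> a \<le> hd \<sigma> \<or> \<sigma> ! q > a \<and> a \<ge> hd \<sigma>" for a q
  proof -
    have "\<sigma> ! q \<in> {1..n}"
      using q perm(1) nth_mem by blast
    then have "preferred \<sigma> a (\<sigma> ! q)"
      using sp a unfolding single_peaked_def by blast
    then show ?thesis
      by (rule preferred_nth_in_take[OF perm(2) q])
  qed
  have convex: "a \<in> S"
    if b: "b \<in> S" and a: "a \<in> {1..n}" "b < a \<and> a \<le> hd \<sigma> \<or> b > a \<and> a \<ge> hd \<sigma>" for a b
  proof -
    obtain q where q: "q < p" "\<sigma> ! q = b"
      using b by (auto simp: S_def in_set_conv_nth)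
    then have "a \<in> set (take q \<sigma>)"
      using a p(2) by (intro earlier) auto
    then show ?thesis
      using q(1) set_take_subset_set_take[of q p \<sigma>] by (auto simp: S_def)
  qed
  have outside: "\<sigma> ! p < m \<or> M < \<sigma> ! p"
  proof (rule ccontr)
    assume "\<not> (\<sigma> ! p < m \<or> M < \<sigma> ! p)"
    moreover have "\<sigma> ! p \<noteq> M" "\<sigma> ! p \<noteq> m"
      using x_notin M(1) m(1) by auto
    ultimately have "m < \<sigma> ! p" "\<sigma> ! p < M"
      by auto
    \<comment> \<open>The side of the peak decides: at or below it \<open>convex\<close> is applied
      from \<open>m\<close>, at or above it from \<open>M\<close>.\<close>
    then have "\<sigma> ! p \<in> S"
      using convex[OF M(1) x] convex[OF m(1) x] by (meson linear)
    with x_notin show False ..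
  qed
  have "\<sigma> ! p = M + 1" if "M < \<sigma> ! p"
  proof (rule ccontr)
    assume "\<sigma> ! p \<noteq> M + 1"
    \<comment> \<open>\<open>M + 1\<close> is a letter because it lies below
      \<open>\<sigma> ! p\<close>, which is at most \<open>n\<close>.\<close>
    then have "M + 1 \<in> S"
      using earlier[OF p(2), of "M + 1"] that x between by (auto simp: S_def)
    then show False
      using Max_ge[OF fin, of "M + 1"] by (simp add: M_def)
  qed
  moreover have "\<sigma> ! p + 1 = m" if "\<sigma> ! p < m"
  proof (rule ccontr)
    assume "\<sigma> ! p + 1 \<noteq> m"
    \<comment> \<open>The subtraction is not truncated, since \<open>m\<close> exceeds
      \<open>\<sigma> ! p\<close>.\<close>
    then have "\<sigma> ! p < m - 1 \<and> m - 1 \<le> hd \<sigma>" "m - 1 \<in> {1..n}"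
      using that between m(2) by auto
    then have "m - 1 \<in> S"
      unfolding S_def by (intro earlier p(2)) auto
    then have "m \<le> m - 1"
      unfolding m_def by (rule Min_le[OF fin])
    then show False
      using that by simp
  qed
  moreover have "sign_case \<sigma> p Plus \<longleftrightarrow> \<sigma> ! p = M + 1" "sign_case \<sigma> p Minus \<longleftrightarrow> \<sigma> ! p + 1 = m"
    by (simp_all add: S_def M_def m_def)
  \<comment> \<open>Both equations together would give \<open>m = M + 2\<close>, although the peak
    lies between \<open>m\<close> and \<open>M\<close>.\<close>
  moreover have "\<not> (\<sigma> ! p = M + 1 \<and> \<sigma> ! p + 1 = m)"
    using between by linarith
  ultimately have "sign_case \<sigma> p Plus \<noteq> sign_case \<sigma> p Minus"
    using outside by blast
  then show ?thesis
    by (metis (full_types) sign.exhaust)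
qed

text \<open>A letter just above the maximum or just below the minimum of a prefix becomes the
  extreme letter of the extended prefix. This form suits decoding from the end, where only the set
  of the extended prefix is known.\<close>

lemma nth_eq_if_sign_case:
  assumes "1 \<le> p" "p < length \<sigma>" "sign_case \<sigma> p c"
  shows "\<sigma> ! p = (case c of Plus \<Rightarrow> Max (set (take (Suc p) \<sigma>)) | Minus \<Rightarrow> Min (set (take (Suc p) \<sigma>)))"
proof -
  have "take p \<sigma> \<noteq> []"
    using assms by auto
  then show ?thesis
    using assms by (cases c) (simp_all add: take_Suc_conv_app_nth)
qed

lemma sign_case_sign_rep:
  assumes "sign_rep_well_defined \<sigma>" "1 \<le> p" "p < length \<sigma>"
  shows "sign_case \<sigma> p (sign_rep \<sigma> ! (p - 1))"
proof -
  have "\<exists>!c. sign_case \<sigma> p c"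
    using assms by (simp add: sign_rep_well_defined_def)
  then have "sign_case \<sigma> p (THE c. sign_case \<sigma> p c)"
    by (rule theI')
  \<comment> \<open>Signs are numbered from 1 but list entries from 0, hence the shift.\<close>
  moreover have "[1..<length \<sigma>] ! (p - 1) = p"
    using assms nth_upt[of 1 "p - 1" "length \<sigma>"] by simp
  ultimately show ?thesis
    using assms by (simp add: sign_rep_def)
qed

lemma sign_rep_inj:
  assumes perm: "\<sigma> \<in> permutations_of_set A" "\<tau> \<in> permutations_of_set A"
    and wd: "sign_rep_well_defined \<sigma>" "sign_rep_well_defined \<tau>"
    and eq: "sign_rep \<sigma> = sign_rep \<tau>"
  shows "\<sigma> = \<tau>"
proof -
  have len: "length \<tau> = length \<sigma>"
    using perm by (metis length_finite_permutations_of_set)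
  have dist: "distinct \<sigma>" "distinct \<tau>" and sets: "set \<sigma> = A" "set \<tau> = A"
    using perm by (auto simp: permutations_of_set_def)
  have "p \<le> length \<sigma> \<Longrightarrow> drop p \<sigma> = drop p \<tau>" for p
  proof (induction rule: inc_induct)
    case base
    then show ?case using len by simp
  next
    case (step p)
    then have p: "p < length \<sigma>" "p < length \<tau>"
      using len by auto
    \<comment> \<open>Both sets are \<open>A\<close> without the letters of the common
      suffix.\<close>
    have prefix: "set (take (Suc p) \<sigma>) = set (take (Suc p) \<tau>)"
      using step.IH by (simp only: set_take_eq_diff_drop dist sets)
    \<comment> \<open>The peak carries no sign; for \<open>p = 0\<close> the prefix is a singleton,
      so its set already determines the letter.\<close>
    have "\<sigma> ! p = \<tau> ! p"
    proof (cases "p = 0")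
      case True
      then show ?thesis
        using prefix p by (simp add: take_Suc_conv_app_nth)
    next
      case False
      then show ?thesis
        using nth_eq_if_sign_case[OF _ p(1) sign_case_sign_rep[OF wd(1) _ p(1)]]
          nth_eq_if_sign_case[OF _ p(2) sign_case_sign_rep[OF wd(2) _ p(2)]] eq
        by (simp add: prefix split: sign.split)
    qed
    then show ?case
      using step.IH p by (metis Cons_nth_drop_Suc)
  qed
  from this[of 0] show ?thesis
    by simp
qed

theorem theorem1:
  fixes n :: nat
  assumes "n \<ge> 1"
  shows "(\<forall>\<sigma>. single_peaked n \<sigma> \<longrightarrow> sign_rep_well_defined \<sigma> \<and> length (sign_rep \<sigma>) = n - 1) \<and>
         (\<forall>\<sigma> \<tau>. single_peaked n \<sigma> \<and> single_peaked n \<tau> \<and> sign_rep \<sigma> = sign_rep \<tau> \<longrightarrow> \<sigma> = \<tau>)"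
proof -
  have perm: "\<sigma> \<in> permutations_of_set {1..n}" if "single_peaked n \<sigma>" for \<sigma>
    using that by (simp add: single_peaked_def)
  have wd: "sign_rep_well_defined \<sigma>" if "single_peaked n \<sigma>" for \<sigma>
    using single_peaked_sign_case_ex1[OF that] by (auto simp: sign_rep_well_defined_def)
  have "length (sign_rep \<sigma>) = n - 1" if "single_peaked n \<sigma>" for \<sigma>
    using length_finite_permutations_of_set[OF perm[OF that]] by (simp add: sign_rep_def)
  then show ?thesis
    using wd perm sign_rep_inj by blast
qed

end
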